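(* Let $m$ and $p$ be integers with $0\le p\le m-1$, and let $P(z)=A_mz^m+A_pz^p+\cdots+A_1z+A_0$ be a matrix polynomial of degree $m$ with coefficients in $\mathbb{M}_{n\times n}$, where $A_0$ and $A_m$ are non-singular. Let $$M=\max_{0\le j\le p}\frac{\|A_j\|}{\|A_m^{-1}\|^{-1}}.$$ Then all the eigenvalues $z$ of $P$ lie in $|z|<k$, where $k>1$ is the unique positive root of the trinomial equation $$x^{m-p}-x^{m-p-1}-M=0.$$
   Context: $\mathbb{M}_{n\times n}$ denotes the set of all $n\times n$ matrices with entries in $\mathbb{C}$. A matrix polynomial is a function $P:\mathbb{C}\to\mathbb{M}_{n\times n}$ of the form $P(z)=\sum_{j=0}^{m}A_jz^j$ with $A_j\in\mathbb{M}_{n\times n}$; it has degree $m$ if $A_m\neq 0$. An eigenvalue of $P$ is a number $\lambda\in\mathbb{C}$ for which there exists a non-zero vector $u\in\mathbb{C}^n$ with $P(\lambda)u=0$. Throughout, $\|\cdot\|$ denotes a subordinate matrix norm on $\mathbb{M}_{n\times n}$, i.e. the operator norm induced by a vector norm on $\mathbb{C}^n$. *)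

theory Defs
  imports "HOL-Analysis.Analysis"
begin

definition matrix_poly :: "nat \<Rightarrow> (nat \<Rightarrow> complex^'n^'n) \<Rightarrow> complex \<Rightarrow> complex^'n^'n" where
  "matrix_poly m A z = (\<Sum>j\<le>m. map_matrix ((*) (z ^ j)) (A j))"

definition matrix_poly_eigenvalue :: "(complex \<Rightarrow> complex^'n^'n) \<Rightarrow> complex \<Rightarrow> bool" where
  "matrix_poly_eigenvalue P z \<longleftrightarrow> (\<exists>u. u \<noteq> 0 \<and> P z *v u = 0)"

(* Homogeneity is over the complex scalars, which is stronger than homogeneity over the reals. *)
definition vector_norm :: "(complex^'n \<Rightarrow> real) \<Rightarrow> bool" where
  "vector_norm N \<longleftrightarrow>
     (\<forall>x. 0 \<le> N x) \<and>
     (\<forall>x. N x = 0 \<longleftrightarrow> x = 0) \<and>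
     (\<forall>c x. N (c *s x) = cmod c * N x) \<and>
     (\<forall>x y. N (x + y) \<le> N x + N y)"

(* For a vector norm N the set of quotients is nonempty and bounded above, so the
   supremum is the genuine one. The analogue for an arbitrary N of the constant onorm,
   which is tied to the type-class norm. *)
definition subordinate_norm :: "(complex^'n \<Rightarrow> real) \<Rightarrow> complex^'n^'n \<Rightarrow> real" where
  "subordinate_norm N A = (SUP x\<in>{x. x \<noteq> 0}. N (A *v x) / N x)"

end

theory Submission
  imports Defs
begin

text \<open>
  Put \<open>q = m - p\<close>, so that \<open>q \<ge> 1\<close> and the trinomial equation reads
  \<open>x ^ (q - 1) * (x - 1) = M\<close>. Here \<open>M > 0\<close>, because \<open>A 0\<close> and the inverse of \<open>A m\<close>
  are non-zero and hence have positive norm. The left-hand side is not positive for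
  \<open>0 < x \<le> 1\<close>, and on \<open>x \<ge> 1\<close> it increases strictly from \<open>0\<close> to infinity. So there is
  exactly one positive root \<open>k\<close>, it exceeds \<open>1\<close>, and every real \<open>r \<ge> k\<close> satisfies
  \<open>r ^ (q - 1) * (r - 1) \<ge> M\<close> (lemma \<open>trinomial_root\<close>).

  Now let \<open>P z *v u = 0\<close> with \<open>u \<noteq> 0\<close>, and let \<open>r = cmod z\<close>. Multiplying by the inverse of
  the leading coefficient isolates \<open>z ^ m *s u\<close>. Taking norms and dividing by \<open>N u\<close> gives
  \<open>r ^ m \<le> M * (\<Sum>j\<le>p. r ^ j)\<close> (lemma \<open>eigenvalue_power_bound\<close>). If \<open>r > 1\<close>, the
  geometric sum is \<open>(r ^ (p + 1) - 1) / (r - 1)\<close>, which is strictly smaller than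
  \<open>r ^ (p + 1) / (r - 1)\<close>. Cancelling \<open>r ^ (p + 1)\<close> yields \<open>r ^ (q - 1) * (r - 1) < M\<close>, so
  \<open>r < k\<close>.

  The inequality \<open>N (A *v x) \<le> subordinate_norm N A * N x\<close> used on the way depends on
  the supremum being taken over a bounded set. This comes from the equivalence of norms in
  finite dimension: \<open>N (A *v x)\<close> is at most a constant times \<open>norm x\<close>, and by compactness of
  the unit sphere \<open>norm x\<close> is at most a constant times \<open>N x\<close>.
\<close>

section \<open>Norms on a finite-dimensional complex space and their operator norms\<close>

lemma vector_norm_nonneg: "vector_norm N \<Longrightarrow> 0 \<le> N x"
  by (simp add: vector_norm_def)

lemma vector_norm_eq_0: "vector_norm N \<Longrightarrow> N x = 0 \<longleftrightarrow> x = 0"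
  by (simp add: vector_norm_def)

lemma vector_norm_pos: "vector_norm N \<Longrightarrow> x \<noteq> 0 \<Longrightarrow> 0 < N x"
  using vector_norm_nonneg[of N x] vector_norm_eq_0[of N x] by linarith

lemma vector_norm_scale: "vector_norm N \<Longrightarrow> N (c *s x) = cmod c * N x"
  by (simp add: vector_norm_def)

lemma vector_norm_triangle: "vector_norm N \<Longrightarrow> N (x + y) \<le> N x + N y"
  by (simp add: vector_norm_def)

lemma vector_norm_minus:
  assumes "vector_norm N"
  shows "N (- x) = N x"
  using vector_norm_scale[OF assms, of "- 1" x] unfolding vector_sneg_minus1[of x] by simp

lemma vector_norm_sum:
  assumes "vector_norm N"
  shows "N (sum f S) \<le> (\<Sum>i\<in>S. N (f i))"
proof (induction S rule: infinite_finite_induct)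
  case (insert i S)
  then show ?case
    using vector_norm_triangle[OF assms, of "f i" "sum f S"] by simp
qed (use vector_norm_eq_0[OF assms, of 0] in auto)

text \<open>
  Expanding \<open>A *v x\<close> in the columns of \<open>A\<close> bounds it by the Euclidean norm of \<open>x\<close>; the
  identity matrix gives the bound for \<open>N\<close> itself.
\<close>

lemma vector_norm_matrix_le_norm:
  fixes A :: "complex^'n^'n"
  assumes "vector_norm N"
  shows "N (A *v x) \<le> (\<Sum>i\<in>UNIV. N (column i A)) * norm x"
proof -
  have "N (A *v x) \<le> (\<Sum>i\<in>UNIV. cmod (x $ i) * N (column i A))"
    unfolding matrix_mult_sum
    using vector_norm_sum[OF assms, of "\<lambda>i. x $ i *s column i A" UNIV]
    by (simp add: vector_norm_scale[OF assms])
  also have "\<dots> \<le> (\<Sum>i\<in>UNIV. norm x * N (column i A))"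
    by (intro sum_mono mult_right_mono Finite_Cartesian_Product.norm_nth_le
        vector_norm_nonneg[OF assms])
  finally show ?thesis
    by (simp add: sum_distrib_left mult.commute)
qed

lemma continuous_on_vector_norm:
  fixes N :: "complex^'n \<Rightarrow> real"
  assumes "vector_norm N"
  shows "continuous_on S N"
proof -
  define C where "C = (\<Sum>i\<in>UNIV. N (column i (mat 1 :: complex^'n^'n)))"
  have le: "N x \<le> C * norm x" for x
    using vector_norm_matrix_le_norm[OF assms, of "mat 1" x] by (simp add: C_def)
  have "N x - N y \<le> C * norm (x - y)" for x y
    using vector_norm_triangle[OF assms, of "x - y" y] le[of "x - y"] by simp
  then have "dist (N x) (N y) \<le> C * dist x y" for x y
    by (simp add: dist_norm abs_le_iff) (metis minus_diff_eq norm_minus_commute)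
  moreover have "0 \<le> C"
    unfolding C_def by (intro sum_nonneg vector_norm_nonneg[OF assms])
  ultimately have "C-lipschitz_on S N"
    by (intro lipschitz_onI)
  then show ?thesis
    by (rule lipschitz_on_continuous_on)
qed

text \<open>
  A continuous function attains its minimum on the compact unit sphere; for \<open>N\<close> this minimum
  is positive by definiteness, and homogeneity spreads the bound to all vectors.
\<close>

lemma norm_le_vector_norm:
  fixes N :: "complex^'n \<Rightarrow> real"
  assumes "vector_norm N"
  obtains c where "c > 0" "\<And>x. c * norm x \<le> N x"
proof -
  have "axis undefined 1 \<in> sphere (0 :: complex^'n) 1"
    by simp
  then obtain y where y: "y \<in> sphere 0 1" "\<And>x. x \<in> sphere 0 1 \<Longrightarrow> N y \<le> N x"
    using continuous_attains_inf[OF compact_sphere _ continuous_on_vector_norm[OF assms]]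
    by (metis empty_iff)
  have "N y * norm x \<le> N x" for x
  proof (cases "x = 0")
    case False
    define c where "c = complex_of_real (inverse (norm x))"
    have "c *s x = inverse (norm x) *\<^sub>R x"
      by (simp add: vec_eq_iff c_def scaleR_conv_of_real[where 'a = complex])
    then have "c *s x \<in> sphere 0 1"
      using False by simp
    then have "N y \<le> inverse (norm x) * N x"
      using y(2)[of "c *s x"] vector_norm_scale[OF assms, of c x] by (simp add: c_def norm_inverse)
    then show ?thesis
      using False by (simp add: field_simps)
  qed (simp add: vector_norm_nonneg[OF assms])
  moreover have "0 < N y"
    using y(1) by (intro vector_norm_pos[OF assms]) auto
  ultimately show ?thesis
    using that by blast
qed

lemma bdd_above_subordinate_norm:
  fixes N :: "complex^'n \<Rightarrow> real"
  assumes "vector_norm N"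
  shows "bdd_above ((\<lambda>x. N (A *v x) / N x) ` {x. x \<noteq> 0})"
proof -
  obtain c where c: "c > 0" "\<And>x. c * norm x \<le> N x"
    using norm_le_vector_norm[OF assms] by blast
  define K where "K = (\<Sum>i\<in>UNIV. N (column i A))"
  have K: "0 \<le> K"
    unfolding K_def by (intro sum_nonneg vector_norm_nonneg[OF assms])
  have "N (A *v x) / N x \<le> K / c" if "x \<noteq> 0" for x
  proof -
    have "N (A *v x) \<le> K * norm x"
      unfolding K_def by (rule vector_norm_matrix_le_norm[OF assms])
    also have "\<dots> \<le> K * (N x / c)"
      using c K by (intro mult_left_mono) (auto simp: field_simps)
    finally show ?thesis
      using vector_norm_pos[OF assms that] by (simp add: field_simps)
  qed
  then show ?thesis
    by (intro bdd_aboveI2) auto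
qed

lemma subordinate_norm_upper:
  fixes N :: "complex^'n \<Rightarrow> real"
  assumes "vector_norm N"
  shows "N (A *v x) \<le> subordinate_norm N A * N x"
proof (cases "x = 0")
  case False
  then have "N (A *v x) / N x \<le> subordinate_norm N A"
    unfolding subordinate_norm_def
    by (intro cSUP_upper bdd_above_subordinate_norm[OF assms]) simp
  then show ?thesis
    using vector_norm_pos[OF assms False] by (simp add: field_simps)
qed (use vector_norm_eq_0[OF assms, of 0] in simp)

lemma subordinate_norm_pos:
  fixes N :: "complex^'n \<Rightarrow> real"
  assumes "vector_norm N" and "A \<noteq> 0"
  shows "0 < subordinate_norm N A"
proof -
  obtain x where "A *v x \<noteq> 0"
    using assms(2) by (metis matrix_eq matrix_vector_mult_0)
  then have "0 < N (A *v x)" "0 < N x"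
    by (auto intro!: vector_norm_pos[OF assms(1)])
  then show ?thesis
    using subordinate_norm_upper[OF assms(1), of A x]
    by (metis less_le_trans zero_less_mult_pos2)
qed

section \<open>The trinomial equation\<close>

text \<open>
  \<open>n\<close> stands for \<open>m - p - 1\<close>. The factor \<open>x ^ n\<close> is at least \<open>1\<close> for \<open>x \<ge> 1\<close>, so the left-hand
  side is already at least \<open>M\<close> at \<open>x = 1 + M\<close>.
\<close>

lemma trinomial_root:
  fixes M :: real
  assumes "0 < M"
  obtains k where "1 < k" "k ^ n * (k - 1) = M"
    "\<forall>x>0. x ^ n * (x - 1) = M \<longrightarrow> x = k"
    "\<forall>x\<ge>k. M \<le> x ^ n * (x - 1)"
proof -
  define f where "f x = x ^ n * (x - 1)" for x :: real
  have mono: "f x < f y" if "1 \<le> x" "x < y" for x y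
  proof -
    have "x ^ n * (x - 1) \<le> y ^ n * (x - 1)"
      using that by (intro mult_right_mono power_mono) auto
    also have "\<dots> < y ^ n * (y - 1)"
      using that by (intro mult_strict_left_mono) auto
    finally show ?thesis
      by (simp add: f_def)
  qed
  have "M \<le> f (1 + M)"
    using assms one_le_power[of "1 + M" n] by (simp add: f_def)
  moreover have "f 1 \<le> M"
    using assms by (simp add: f_def)
  moreover have "continuous_on {1..1 + M} f"
    unfolding f_def by (intro continuous_intros)
  ultimately obtain k where k: "1 \<le> k" "f k = M"
    using IVT'[of f 1 M "1 + M"] assms by auto
  have "k \<noteq> 1"
    using k(2) assms by (auto simp: f_def)
  with k(1) have "1 < k"
    by simp
  have unique: "x = k" if "0 < x" "f x = M" for x
  proof -
    have "0 < x ^ n * (x - 1)"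
      using that assms by (simp add: f_def)
    then have "1 < x"
      using that(1) by (simp add: zero_less_mult_iff)
    then show ?thesis
      using mono[of x k] mono[of k x] k that(2) by force
  qed
  have "M \<le> f x" if "k \<le> x" for x
    using mono[of k x] that k by (cases "x = k") auto
  with that \<open>1 < k\<close> k(2) unique show ?thesis
    unfolding f_def by blast
qed

text \<open>
  The form in which the geometric sum enters: multiplying by \<open>r - 1\<close> telescopes it to
  \<open>r ^ (p + 1) - 1\<close>, and the discarded \<open>-1\<close> is what makes the conclusion strict.
\<close>

lemma power_le_geometric_sum_imp:
  fixes r M :: real
  assumes "1 < r" "0 < M" "p < m"
    and le: "r ^ m \<le> M * (\<Sum>j\<le>p. r ^ j)"
  shows "r ^ (m - p - 1) * (r - 1) < M"
proof -
  have "r ^ (m - p - 1) * (r - 1) * r ^ Suc p = r ^ m * (r - 1)"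
  proof -
    have "r ^ m = r ^ (m - p - 1) * r ^ Suc p"
      using \<open>p < m\<close> by (simp flip: power_add power_Suc)
    then show ?thesis
      by (simp only: mult_ac)
  qed
  also have "\<dots> \<le> M * (\<Sum>j\<le>p. r ^ j) * (r - 1)"
    using le \<open>1 < r\<close> by (intro mult_right_mono) auto
  also have "\<dots> = M * (r ^ Suc p - 1)"
    by (simp only: power_diff_1_eq[of r "Suc p"] lessThan_Suc_atMost mult_ac)
  also have "\<dots> < M * r ^ Suc p"
    using \<open>0 < M\<close> by simp
  finally show ?thesis
    using \<open>1 < r\<close> by (simp del: power_Suc)
qed

section \<open>Eigenvalues of a lacunary matrix polynomial\<close>

lemma map_matrix_scale_mult_vec:
  fixes A :: "complex^'n^'n"
  shows "map_matrix ((*) c) A *v x = c *s (A *v x)"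
  by (simp add: vec_eq_iff matrix_vector_mult_def map_matrix_def sum_distrib_left mult.assoc)

lemma matrix_vector_mult_sum_left:
  fixes F :: "'a \<Rightarrow> complex^'n^'n"
  shows "sum F S *v x = (\<Sum>j\<in>S. F j *v x)"
  by (induction S rule: infinite_finite_induct) (auto simp: matrix_vector_mult_add_rdistrib)

lemma matrix_inv_left_right:
  fixes A :: "complex^'n^'n"
  assumes "invertible A"
  shows "A ** matrix_inv A = mat 1" "matrix_inv A ** A = mat 1"
proof -
  have "A ** matrix_inv A = mat 1 \<and> matrix_inv A ** A = mat 1"
    using assms unfolding invertible_def matrix_inv_def by (rule someI_ex)
  then show "A ** matrix_inv A = mat 1" "matrix_inv A ** A = mat 1"
    by auto
qed

lemma matrix_left_right_inverse_nonzero: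
  fixes A B :: "complex^'n^'n"
  assumes "A ** B = mat 1"
  shows "A \<noteq> 0" "B \<noteq> 0"
proof -
  have "A *v (B *v axis undefined 1) = axis undefined 1"
    by (simp add: matrix_vector_mul_assoc assms)
  moreover have "axis undefined 1 \<noteq> (0 :: complex^'n)"
    by simp
  ultimately show "A \<noteq> 0" "B \<noteq> 0"
    by auto
qed

lemma matrix_poly_mult_vec: "matrix_poly m A z *v u = (\<Sum>j\<le>m. z ^ j *s (A j *v u))"
  by (simp add: matrix_poly_def matrix_vector_mult_sum_left map_matrix_scale_mult_vec)

lemma matrix_poly_mult_vec_lacunary:
  assumes "p < m" "\<And>j. p < j \<Longrightarrow> j < m \<Longrightarrow> A j = 0"
  shows "matrix_poly m A z *v u = z ^ m *s (A m *v u) + (\<Sum>j\<le>p. z ^ j *s (A j *v u))"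
proof -
  have "(\<Sum>j\<le>m. z ^ j *s (A j *v u)) = (\<Sum>j\<in>insert m {..p}. z ^ j *s (A j *v u))"
    by (rule sum.mono_neutral_right) (use assms in \<open>auto simp: not_le\<close>)
  then show ?thesis
    using assms(1) by (simp add: matrix_poly_mult_vec)
qed

text \<open>
  For an eigenvector \<open>u\<close>, the inverse of the leading coefficient turns the eigenvalue equation
  into \<open>z ^ m *s u = - (\<Sum>j\<le>p. z ^ j *s (matrix_inv (A m) *v (A j *v u)))\<close>; each summand has
  norm at most \<open>cmod z ^ j * M * N u\<close>.
\<close>

lemma eigenvalue_power_bound:
  fixes A :: "nat \<Rightarrow> complex^'n^'n"
  assumes N: "vector_norm N"
    and "p < m" "\<And>j. p < j \<Longrightarrow> j < m \<Longrightarrow> A j = 0"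
    and inv: "invertible (A m)"
    and M: "\<And>j. j \<le> p \<Longrightarrow> subordinate_norm N (matrix_inv (A m)) * subordinate_norm N (A j) \<le> M"
    and eig: "matrix_poly_eigenvalue (matrix_poly m A) z"
  shows "cmod z ^ m \<le> M * (\<Sum>j\<le>p. cmod z ^ j)"
proof -
  let ?B = "matrix_inv (A m)"
  obtain u where u: "u \<noteq> 0" "matrix_poly m A z *v u = 0"
    using eig by (auto simp: matrix_poly_eigenvalue_def)
  have B0: "?B \<noteq> 0"
    by (rule matrix_left_right_inverse_nonzero(2)[OF matrix_inv_left_right(1)[OF inv]])
  have summand: "N (?B *v (z ^ j *s (A j *v u))) \<le> cmod z ^ j * (M * N u)" if "j \<le> p" for j
  proof -
    have "N (?B *v (A j *v u)) \<le> subordinate_norm N ?B * N (A j *v u)"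
      by (rule subordinate_norm_upper[OF N])
    also have "\<dots> \<le> subordinate_norm N ?B * (subordinate_norm N (A j) * N u)"
      using subordinate_norm_pos[OF N B0]
      by (intro mult_left_mono subordinate_norm_upper[OF N]) auto
    also have "\<dots> \<le> M * N u"
      using M[OF that] vector_norm_nonneg[OF N, of u]
      by (simp add: mult.assoc[symmetric] mult_right_mono)
    finally show ?thesis
      by (simp add: vector_scalar_commute vector_norm_scale[OF N] norm_power mult_left_mono)
  qed
  have "z ^ m *s u = ?B *v (z ^ m *s (A m *v u))"
    by (simp add: vector_scalar_commute matrix_vector_mul_assoc matrix_inv_left_right(2)[OF inv])
  also have "z ^ m *s (A m *v u) = - (\<Sum>j\<le>p. z ^ j *s (A j *v u))"
    using u(2) matrix_poly_mult_vec_lacunary[where A = A, OF assms(2,3)]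
    by (simp add: eq_neg_iff_add_eq_0)
  also have "?B *v \<dots> = - (\<Sum>j\<le>p. ?B *v (z ^ j *s (A j *v u)))"
    by (simp only: vec.neg vec.sum)
  finally have "N (z ^ m *s u) = N (\<Sum>j\<le>p. ?B *v (z ^ j *s (A j *v u)))"
    by (simp add: vector_norm_minus[OF N])
  also have "\<dots> \<le> (\<Sum>j\<le>p. N (?B *v (z ^ j *s (A j *v u))))"
    by (rule vector_norm_sum[OF N])
  also have "\<dots> \<le> (\<Sum>j\<le>p. cmod z ^ j * (M * N u))"
    using summand by (intro sum_mono) auto
  also have "\<dots> = (M * (\<Sum>j\<le>p. cmod z ^ j)) * N u"
    by (simp add: sum_distrib_left sum_distrib_right mult_ac)
  finally show ?thesis
    using vector_norm_pos[OF N u(1)] by (simp add: vector_norm_scale[OF N] norm_power)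
qed

theorem theorem3:
  fixes m p :: nat
    and A :: "nat \<Rightarrow> complex^'n^'n"
    and P :: "complex \<Rightarrow> complex^'n^'n"
    and N :: "complex^'n \<Rightarrow> real"
    and M :: real
  assumes "vector_norm N"
    and "p < m"
    and "P = matrix_poly m A"
    and "A m \<noteq> 0"
    and "\<And>j. p < j \<Longrightarrow> j < m \<Longrightarrow> A j = 0"
    and "invertible (A 0)"
    and "invertible (A m)"
    and "M = Max ((\<lambda>j. subordinate_norm N (A j)
                        / inverse (subordinate_norm N (matrix_inv (A m)))) ` {0..p})"
  shows "\<exists>k::real. k > 1 \<and> k ^ (m - p) - k ^ (m - p - 1) - M = 0 \<and>
           (\<forall>x>0. x ^ (m - p) - x ^ (m - p - 1) - M = 0 \<longrightarrow> x = k) \<and>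
           (\<forall>z. matrix_poly_eigenvalue P z \<longrightarrow> cmod z < k)"
proof -
  note N = assms(1)
  let ?q = "\<lambda>j. subordinate_norm N (A j) / inverse (subordinate_norm N (matrix_inv (A m)))"
  have q_le: "?q j \<le> M" if "j \<le> p" for j
    unfolding assms(8) using that by (intro Max_ge) auto
  have "0 < ?q 0"
    using matrix_left_right_inverse_nonzero(1)[OF matrix_inv_left_right(1)[OF assms(6)]]
      matrix_left_right_inverse_nonzero(2)[OF matrix_inv_left_right(1)[OF assms(7)]]
    by (simp add: subordinate_norm_pos[OF N])
  with q_le[of 0] have "0 < M"
    by linarith
  then obtain k where k: "1 < k" "k ^ (m - p - 1) * (k - 1) = M"
    "\<forall>x>0. x ^ (m - p - 1) * (x - 1) = M \<longrightarrow> x = k"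
    "\<forall>x\<ge>k. M \<le> x ^ (m - p - 1) * (x - 1)"
    by (rule trinomial_root[where n = "m - p - 1"])
  have factor: "x ^ (m - p) - x ^ (m - p - 1) = x ^ (m - p - 1) * (x - 1)" for x :: real
    using assms(2) by (cases "m - p") (auto simp: algebra_simps)
  have "cmod z < k" if "matrix_poly_eigenvalue P z" for z
  proof (rule ccontr)
    assume "\<not> cmod z < k"
    then have ge: "k \<le> cmod z"
      by simp
    have "cmod z ^ m \<le> M * (\<Sum>j\<le>p. cmod z ^ j)"
    proof (rule eigenvalue_power_bound[where A = A, OF N assms(2) assms(5) assms(7)])
      show "subordinate_norm N (matrix_inv (A m)) * subordinate_norm N (A j) \<le> M" if "j \<le> p" for j
        using q_le[OF that] by (simp add: divide_inverse mult.commute)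
      show "matrix_poly_eigenvalue (matrix_poly m A) z"
        using that by (simp only: assms(3))
    qed
    then have "cmod z ^ (m - p - 1) * (cmod z - 1) < M"
      using ge k(1) by (intro power_le_geometric_sum_imp[OF _ \<open>0 < M\<close> assms(2)]) auto
    with k(4) ge show False
      by (meson not_le)
  qed
  moreover have "x ^ (m - p) - x ^ (m - p - 1) - M = 0 \<longleftrightarrow> x ^ (m - p - 1) * (x - 1) = M"
    for x :: real
    using factor[of x] by linarith
  ultimately show ?thesis
    using k by blast
qed

end
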